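(* Let $m,n\geq2$, let $\mathbf p\in\mathbb R^m$, $\mathbf q\in\mathbb R^n$ be probability vectors with all entries strictly positive, and let $\Psi$ be a strict Schur-concave function on $\mathcal C(\mathbf p,\mathbf q)$. Then all minimal value points of $\Psi$ lie in $\mathscr C(\mathbf p,\mathbf q)$, and $$\inf_{P\in\mathcal C(\mathbf p,\mathbf q)}\Psi(P)=\min_{P\in\mathscr C(\mathbf p,\mathbf q)}\Psi(P),$$ where $\mathscr C(\mathbf p,\mathbf q)=\mathcal C_e(\mathbf p,\mathbf q)$ is the set of extreme points of $\mathcal C(\mathbf p,\mathbf q)$.
   Context: $\mathcal C(\mathbf p,\mathbf q)$: nonnegative $m\times n$ matrices with row sums $p_i$, column sums $q_j$, viewed as vectors in $\mathbb R^{mn}$; $\mathcal C_e(\mathbf p,\mathbf q)$: its extreme points; $V(P)=\{(i,j):p_{i,j}\ne0\}$. $\mathscr C(\mathbf p,\mathbf q)$: the set of $P\in\mathcal C(\mathbf p,\mathbf q)$ with $V(P)\subset T$ for some tree $T\subset[m]\times[n]$ with $|T|=m+n-1$ (graph notions: distinct points adjacent iff they share a row or column; a circuit is a cyclic sequence of $s\ge4$ pairwise distinct points $v_k=(i_k,j_k)$ with, indices mod $s$, $v_k,v_{k+1}$ adjacent and $(i_{k+2}-i_k)(j_{k+2}-j_k)\ne0$; a tree is a connected subset with no circuit). Majorization: for $x,y\in\mathbb R^N$ let $\bar x,\bar y$ be the decreasing rearrangements and $F_{\bar x}(i)=\sum_{k\le i}\bar x_k$; $x\preceq y$ if $F_{\bar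 x}(i)\le F_{\bar y}(i)$ for $1\le i<N$ and $F_{\bar x}(N)=F_{\bar y}(N)$; $x\prec y$ if moreover $F_{\bar x}(i)<F_{\bar y}(i)$ for some $i<N$. $\Psi$ (symmetric in the entries) is Schur-concave if $x\preceq y$ implies $\Psi(x)\ge\Psi(y)$, and strict Schur-concave if moreover $x\prec y$ implies $\Psi(x)>\Psi(y)$. *)

theory Defs
  imports Complex_Main
begin

text \<open>An m x n matrix is a function on index pairs (i,j), with 1 \<le> i \<le> m, 1 \<le> j \<le> n,
  required to vanish outside the index box.\<close>

type_synonym mat = "nat \<times> nat \<Rightarrow> real"

definition box :: "nat \<Rightarrow> nat \<Rightarrow> (nat \<times> nat) set" where
  "box m n = {1..m} \<times> {1..n}"

definition transport_polytope :: "nat \<Rightarrow> nat \<Rightarrow> (nat \<Rightarrow> real) \<Rightarrow> (nat \<Rightarrow> real) \<Rightarrow> mat set"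
  ("\<C>") where
  "\<C> m n p q = {P. (\<forall>x. P x \<ge> 0) \<and> (\<forall>x. x \<notin> box m n \<longrightarrow> P x = 0)
      \<and> (\<forall>i\<in>{1..m}. (\<Sum>j=1..n. P (i,j)) = p i)
      \<and> (\<forall>j\<in>{1..n}. (\<Sum>i=1..m. P (i,j)) = q j)}"

definition extreme_points :: "mat set \<Rightarrow> mat set" where
  "extreme_points S = {P \<in> S. \<not> (\<exists>Q\<in>S. \<exists>R\<in>S. \<exists>t::real. 0 < t \<and> t < 1 \<and> Q \<noteq> R
        \<and> P = (\<lambda>x. t * Q x + (1 - t) * R x))}"

definition supp_mat :: "nat \<Rightarrow> nat \<Rightarrow> mat \<Rightarrow> (nat \<times> nat) set" where
  "supp_mat m n P = {x \<in> box m n. P x \<noteq> 0}"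

definition adjacent :: "nat \<times> nat \<Rightarrow> nat \<times> nat \<Rightarrow> bool" where
  "adjacent a b \<longleftrightarrow> a \<noteq> b \<and> (fst a = fst b \<or> snd a = snd b)"

definition has_circuit :: "(nat \<times> nat) set \<Rightarrow> bool" where
  "has_circuit T \<longleftrightarrow> (\<exists>s::nat. \<exists>v::nat \<Rightarrow> nat \<times> nat. s \<ge> 4 \<and> inj_on v {..<s} \<and> v ` {..<s} \<subseteq> T
     \<and> (\<forall>k<s. adjacent (v k) (v ((k + 1) mod s))
        \<and> (int (fst (v ((k + 2) mod s))) - int (fst (v k)))
          * (int (snd (v ((k + 2) mod s))) - int (snd (v k))) \<noteq> 0))"

definition connected_pts :: "(nat \<times> nat) set \<Rightarrow> bool" where
  "connected_pts T \<longleftrightarrow> (\<forall>a\<in>T. \<forall>b\<in>T. (\<lambda>x y. x \<in> T \<and> y \<in> T \<and> adjacent x y)\<^sup>*\<^sup>* a b)"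

definition is_tree :: "(nat \<times> nat) set \<Rightarrow> bool" where
  "is_tree T \<longleftrightarrow> connected_pts T \<and> \<not> has_circuit T"

definition tree_polytope_pts :: "nat \<Rightarrow> nat \<Rightarrow> (nat \<Rightarrow> real) \<Rightarrow> (nat \<Rightarrow> real) \<Rightarrow> mat set" where
  "tree_polytope_pts m n p q = {P \<in> \<C> m n p q. \<exists>T. T \<subseteq> box m n \<and> is_tree T
        \<and> card T = m + n - 1 \<and> supp_mat m n P \<subseteq> T}"

text \<open>Vectorisation of a matrix as a vector in R^(mn) (order irrelevant for majorization).\<close>
definition vec_mat :: "nat \<Rightarrow> nat \<Rightarrow> mat \<Rightarrow> real list" where
  "vec_mat m n P = map P (List.product [1..<m+1] [1..<n+1])"

definition partial_top :: "real list \<Rightarrow> nat \<Rightarrow> real" where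
  "partial_top x i = sum_list (take i (rev (sort x)))"

definition majorized :: "real list \<Rightarrow> real list \<Rightarrow> bool" where
  "majorized x y \<longleftrightarrow> length x = length y
     \<and> (\<forall>i. 1 \<le> i \<and> i < length x \<longrightarrow> partial_top x i \<le> partial_top y i)
     \<and> partial_top x (length x) = partial_top y (length y)"

definition strictly_majorized :: "real list \<Rightarrow> real list \<Rightarrow> bool" where
  "strictly_majorized x y \<longleftrightarrow> majorized x y
     \<and> (\<exists>i. 1 \<le> i \<and> i < length x \<and> partial_top x i < partial_top y i)"

definition strict_schur_concave_on :: "nat \<Rightarrow> nat \<Rightarrow> mat set \<Rightarrow> (mat \<Rightarrow> real) \<Rightarrow> bool" where
  "strict_schur_concave_on m n S \<Psi> \<longleftrightarrow>
     (\<forall>P\<in>S. \<forall>Q\<in>S. majorized (vec_mat m n P) (vec_mat m n Q) \<longrightarrow> \<Psi> P \<ge> \<Psi> Q)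
   \<and> (\<forall>P\<in>S. \<forall>Q\<in>S. strictly_majorized (vec_mat m n P) (vec_mat m n Q) \<longrightarrow> \<Psi> P > \<Psi> Q)"

end

theory Submission
  imports Defs "HOL-Library.Multiset"
begin

text \<open>If a is the largest entry of a 2 x 2 submatrix and its two neighbours b, c are nonzero, shifting
  the mass \<open>min b c\<close> from b and c to a and the opposite entry gives a strictly majorizing matrix with
  the same margins. Doing this around the largest entry of P clears its row or its column, which can
  then be split off as a leaf; by induction every P is majorized by a Q supported on a spanning tree of
  the bipartite graph of rows and columns, strictly unless P = Q. Hence no minimizer lies outside the
  tree points, and a minimum over the finitely many tree points is a minimum over the polytope.

  Tree points are the extreme points because a nonzero matrix with zero margins has a support without
  leaves, and such a support contains a cycle; conversely the alternating sum along a cycle in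
  the support of P is a direction in which P can be moved both ways.\<close>

section \<open>Majorization by hinge sums\<close>

text \<open>Hinge sums replace sorted partial sums because they are local: a change of four entries
  changes only four summands.\<close>

definition hinge :: "real \<Rightarrow> real \<Rightarrow> real" where
  "hinge t x = max (x - t) 0"

text \<open>Termwise \<open>y\<close> is at most \<open>t + hinge t y\<close>, and the entries
  dropped from the sum have nonnegative hinge values.\<close>

lemma sum_list_take_le_hinge:
  assumes "i \<le> length ys"
  shows "sum_list (take i ys) \<le> real i * t + sum_list (map (hinge t) ys)"
proof -
  have "sum_list (take i ys) = (\<Sum>y\<leftarrow>take i ys. y)" by simp
  also have "\<dots> \<le> (\<Sum>y\<leftarrow>take i ys. t + hinge t y)"
    by (rule sum_list_mono) (simp add: hinge_def)
  also have "\<dots> = real i * t + sum_list (map (hinge t) (take i ys))"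
    using assms by (simp add: sum_list_addf sum_list_triv)
  also have "\<dots> \<le> real i * t + (sum_list (map (hinge t) (take i ys)) + sum_list (map (hinge t) (drop i ys)))"
    by (auto simp: hinge_def intro!: sum_list_nonneg)
  also have "sum_list (map (hinge t) (take i ys)) + sum_list (map (hinge t) (drop i ys))
      = sum_list (map (hinge t) ys)"
    by (metis append_take_drop_id map_append sum_list_append)
  finally show ?thesis .
qed

text \<open>The preceding bound is attained at the i-th largest entry: the first \<open>i\<close>
  entries are at least \<open>t\<close>, so \<open>t + hinge t y = y\<close> there, and the hinges
  of the others vanish.\<close>

lemma sum_list_take_eq_hinge:
  assumes "sorted (rev ys)" "1 \<le> i" "i \<le> length ys" and t: "t = ys ! (i - 1)"
  shows "sum_list (take i ys) = real i * t + sum_list (map (hinge t) ys)"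
proof -
  have desc: "ys ! b \<le> ys ! a" if "a \<le> b" "b < length ys" for a b
    using assms(1) that by (simp add: sorted_rev_nth_mono)
  have hi: "t + hinge t y = y" if y: "y \<in> set (take i ys)" for y
  proof -
    obtain a where "a < i" "y = ys ! a" using y assms(3) by (auto simp: in_set_conv_nth)
    then have "t \<le> y" using desc[of a "i - 1"] assms t by auto
    then show ?thesis by (simp add: hinge_def)
  qed
  have lo: "hinge t y = 0" if y: "y \<in> set (drop i ys)" for y
  proof -
    obtain a where "a < length (drop i ys)" "drop i ys ! a = y" using y by (metis in_set_conv_nth)
    then have "i + a < length ys" "y = ys ! (i + a)" using assms(3) by auto
    then have "y \<le> t" using desc[of "i - 1" "i + a"] assms t by auto
    then show ?thesis by (simp add: hinge_def)
  qed
  have "sum_list (map (hinge t) (drop i ys)) = sum_list (map (\<lambda>_. 0) (drop i ys))"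
    by (intro arg_cong[of _ _ sum_list] map_cong refl lo)
  then have "sum_list (map (hinge t) (drop i ys)) = 0" by simp
  moreover have "sum_list (map (hinge t) (take i ys)) + sum_list (map (hinge t) (drop i ys))
      = sum_list (map (hinge t) ys)"
    by (metis append_take_drop_id map_append sum_list_append)
  ultimately have "sum_list (map (hinge t) ys) = sum_list (map (hinge t) (take i ys))" by simp
  moreover have "real i * t + sum_list (map (hinge t) (take i ys)) = (\<Sum>y\<leftarrow>take i ys. t + hinge t y)"
    using assms by (simp add: sum_list_addf sum_list_triv)
  moreover have "map (\<lambda>y. t + hinge t y) (take i ys) = take i ys"
    using hi by (simp add: map_idI)
  ultimately show ?thesis by simp
qed

lemma sum_list_map_rev_sort:
  fixes f :: "real \<Rightarrow> real"
  shows "sum_list (map f (rev (sort x))) = sum_list (map f x)"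
  by (metis mset_map mset_rev mset_sort sum_mset_sum_list)

text \<open>For each \<open>i\<close>, choose the \<open>t\<close> at which the hinge bound is tight
  for \<open>y\<close>; for \<open>x\<close> the bound holds at every \<open>t\<close>.\<close>

lemma majorized_if_hinge:
  assumes len: "length x = length y" and tot: "sum_list x = sum_list y"
    and h: "\<And>t. sum_list (map (hinge t) x) \<le> sum_list (map (hinge t) y)"
  shows "majorized x y"
  unfolding majorized_def
proof (intro conjI allI impI)
  show "length x = length y" by fact
  show "partial_top x (length x) = partial_top y (length y)"
    using tot sum_list_map_rev_sort[of "\<lambda>a. a" x] sum_list_map_rev_sort[of "\<lambda>a. a" y]
    by (simp add: partial_top_def)
next
  fix i assume i: "1 \<le> i \<and> i < length x"
  \<comment> \<open>Lists are indexed from 0, so this is the i-th largest entry of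
    \<open>y\<close>.\<close>
  define t where "t = rev (sort y) ! (i - 1)"
  have "partial_top x i \<le> real i * t + sum_list (map (hinge t) x)"
    unfolding partial_top_def sum_list_map_rev_sort[of _ x, symmetric]
    using i by (intro sum_list_take_le_hinge) simp
  also have "\<dots> \<le> real i * t + sum_list (map (hinge t) y)" using h by simp
  also have "\<dots> = partial_top y i"
    unfolding partial_top_def sum_list_map_rev_sort[of _ y, symmetric]
    using i len by (intro sum_list_take_eq_hinge[symmetric]) (simp_all add: t_def)
  finally show "partial_top x i \<le> partial_top y i" .
qed

text \<open>Successive differences of the partial sums recover the sorted list.\<close>

lemma mset_eq_if_partial_top_eq:
  assumes "length x = length y" and "\<And>i. 1 \<le> i \<Longrightarrow> i \<le> length x \<Longrightarrow> partial_top x i = partial_top y i"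
  shows "mset x = mset y"
proof -
  have eq: "partial_top x i = partial_top y i" if "i \<le> length x" for i
    using assms(2)[of i] that by (cases "i = 0") (auto simp: partial_top_def)
  have "rev (sort x) = rev (sort y)"
  proof (rule nth_equalityI)
    show "length (rev (sort x)) = length (rev (sort y))" using assms by simp
    fix k assume k: "k < length (rev (sort x))"
    have "partial_top z (Suc k) = partial_top z k + rev (sort z) ! k" if "k < length z" for z
      using that by (simp add: partial_top_def take_Suc_conv_app_nth)
    from this[of x] this[of y] show "rev (sort x) ! k = rev (sort y) ! k"
      using k assms eq[of k] eq[of "Suc k"] by simp
  qed
  then show ?thesis by (metis mset_rev mset_sort)
qed

lemma strictly_majorized_if:
  assumes maj: "majorized x y" and ne: "mset x \<noteq> mset y"
  shows "strictly_majorized x y"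
proof (rule ccontr)
  assume "\<not> strictly_majorized x y"
  then have "partial_top x i = partial_top y i" if "1 \<le> i" "i \<le> length x" for i
    using maj that unfolding strictly_majorized_def majorized_def
    by (metis antisym_conv2 le_neq_implies_less)
  then show False using mset_eq_if_partial_top_eq[of x y] maj ne by (auto simp: majorized_def)
qed

text \<open>By the hinge-sum characterization of majorization, \<open>spread\<close> says that Q majorizes P on B.
  The second conjunct encodes strictness: a strictly larger sum of squares shows that P and Q are
  not rearrangements of each other.\<close>

definition spread :: "'a set \<Rightarrow> ('a \<Rightarrow> real) \<Rightarrow> ('a \<Rightarrow> real) \<Rightarrow> bool" where
  "spread B P Q \<longleftrightarrow> (\<forall>t. (\<Sum>x\<in>B. hinge t (P x)) \<le> (\<Sum>x\<in>B. hinge t (Q x)))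
     \<and> (P = Q \<or> (\<Sum>x\<in>B. (P x)\<^sup>2) < (\<Sum>x\<in>B. (Q x)\<^sup>2))"

lemma spread_refl [simp]: "spread B P P"
  by (simp add: spread_def)

lemma spread_trans: "spread B P Q \<Longrightarrow> spread B Q R \<Longrightarrow> spread B P R"
  unfolding spread_def by (meson order_trans less_trans)

section \<open>Matrices as vectors\<close>

lemma finite_box [simp]: "finite (box m n)"
  by (simp add: box_def)

lemma sum_list_vec_mat:
  fixes f :: "real \<Rightarrow> real"
  shows "sum_list (map f (vec_mat m n P)) = (\<Sum>x\<in>box m n. f (P x))"
proof -
  have d: "distinct (List.product [1..<m+1] [1..<n+1])" by (intro distinct_product) auto
  have s: "set (List.product [1..<m+1] [1..<n+1]) = box m n" by (auto simp: box_def)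
  show ?thesis
    unfolding vec_mat_def map_map sum_list_distinct_conv_sum_set[OF d] s by (simp add: o_def)
qed

lemma sum_box: "(\<Sum>x\<in>box m n. f x) = (\<Sum>i=1..m. \<Sum>j=1..n. f (i, j))"
  by (simp add: box_def sum.cartesian_product)

lemma spread_majorized:
  assumes P: "P \<in> \<C> m n p q" and Q: "Q \<in> \<C> m n p q" and s: "spread (box m n) P Q"
  shows "majorized (vec_mat m n P) (vec_mat m n Q)"
    and "P \<noteq> Q \<Longrightarrow> strictly_majorized (vec_mat m n P) (vec_mat m n Q)"
proof -
  show m: "majorized (vec_mat m n P) (vec_mat m n Q)"
  proof (rule majorized_if_hinge)
    show "length (vec_mat m n P) = length (vec_mat m n Q)" by (simp add: vec_mat_def)
    have "(\<Sum>x\<in>box m n. P x) = (\<Sum>x\<in>box m n. Q x)"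
      using P Q by (simp add: sum_box transport_polytope_def)
    then show "sum_list (vec_mat m n P) = sum_list (vec_mat m n Q)"
      using sum_list_vec_mat[of "\<lambda>x. x" m n] by simp
  qed (use s in \<open>simp add: sum_list_vec_mat spread_def\<close>)
  assume "P \<noteq> Q"
  \<comment> \<open>The sum of squares is invariant under rearrangement, so different values
    separate the multisets of entries.\<close>
  then have "sum_list (map power2 (vec_mat m n P)) \<noteq> sum_list (map power2 (vec_mat m n Q))"
    using s by (simp add: sum_list_vec_mat spread_def)
  then have "mset (vec_mat m n P) \<noteq> mset (vec_mat m n Q)"
    by (metis mset_map sum_mset_sum_list)
  then show "strictly_majorized (vec_mat m n P) (vec_mat m n Q)"
    by (rule strictly_majorized_if[OF m])
qed

section \<open>Spreading a matrix onto a spanning tree\<close>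

text \<open>Relative to a rectangle, since the later inductions delete rows and columns. With the
  zero matrix as second argument it describes the kernel of the margin map.\<close>

definition same_margins :: "nat set \<Rightarrow> nat set \<Rightarrow> mat \<Rightarrow> mat \<Rightarrow> bool" where
  "same_margins I J P Q \<longleftrightarrow> (\<forall>i\<in>I. (\<Sum>j\<in>J. P (i, j)) = (\<Sum>j\<in>J. Q (i, j)))
     \<and> (\<forall>j\<in>J. (\<Sum>i\<in>I. P (i, j)) = (\<Sum>i\<in>I. Q (i, j)))"

text \<open>Say \<open>\<delta> = b\<close>. Then \<open>(a, c)\<close> becomes
  \<open>(a + b, c - b)\<close>, pulled apart since \<open>c \<le> a\<close>, and
  \<open>(b, d)\<close> becomes \<open>(0, d + b)\<close>, pulled apart since
  \<open>0 \<le> d\<close>. A convex function gains on both pairs. The case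
  \<open>\<delta> = c\<close> is symmetric.\<close>

lemma hinge_move:
  assumes "b \<le> a" "c \<le> a" "d \<le> a" "\<delta> = b \<or> \<delta> = c" "\<delta> \<le> b" "\<delta> \<le> c" "0 \<le> \<delta>" "0 \<le> d"
  shows "hinge t a + hinge t b + hinge t c + hinge t d
    \<le> hinge t (a + \<delta>) + hinge t (b - \<delta>) + hinge t (c - \<delta>) + hinge t (d + \<delta>)"
  using assms unfolding hinge_def by (smt (verit))

lemma square_move:
  fixes a :: real
  assumes "b \<le> a" "c \<le> a" "d \<le> a" "\<delta> = b \<or> \<delta> = c" "\<delta> \<le> b" "\<delta> \<le> c" "0 < \<delta>" "0 \<le> d"
  shows "a\<^sup>2 + b\<^sup>2 + c\<^sup>2 + d\<^sup>2 < (a + \<delta>)\<^sup>2 + (b - \<delta>)\<^sup>2 + (c - \<delta>)\<^sup>2 + (d + \<delta>)\<^sup>2"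
proof -
  have "(a + \<delta>)\<^sup>2 + (b - \<delta>)\<^sup>2 + (c - \<delta>)\<^sup>2 + (d + \<delta>)\<^sup>2 - (a\<^sup>2 + b\<^sup>2 + c\<^sup>2 + d\<^sup>2)
      = 2 * \<delta> * ((a + d - b - c) + 2 * \<delta>)"
    by (simp add: power2_eq_square algebra_simps)
  \<comment> \<open>One of \<open>b\<close>, \<open>c\<close> equals \<open>\<delta>\<close> and the
    other is at most \<open>a\<close>, so the second factor is at least
    \<open>\<delta>\<close>.\<close>
  moreover have "0 < \<delta> * ((a + d - b - c) + 2 * \<delta>)"
    using assms by (intro mult_pos_pos) linarith+
  ultimately show ?thesis by linarith
qed

definition move :: "nat \<Rightarrow> nat \<Rightarrow> nat \<Rightarrow> nat \<Rightarrow> real \<Rightarrow> mat \<Rightarrow> mat" where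
  "move i j i' j' \<delta> P = P((i, j) := P (i, j) + \<delta>, (i', j') := P (i', j') + \<delta>,
     (i, j') := P (i, j') - \<delta>, (i', j) := P (i', j) - \<delta>)"

text \<open>Kept for arbitrary \<open>f\<close> to serve both conjuncts of \<open>spread\<close>:
  the hinge functions and the square.\<close>

lemma sum_move:
  fixes f :: "real \<Rightarrow> real"
  assumes "finite B" "i \<noteq> i'" "j \<noteq> j'" "{(i, j), (i', j'), (i, j'), (i', j)} \<subseteq> B"
  shows "(\<Sum>x\<in>B. f (move i j i' j' \<delta> P x)) - (\<Sum>x\<in>B. f (P x))
    = (f (P (i, j) + \<delta>) + f (P (i', j') + \<delta>) + f (P (i, j') - \<delta>) + f (P (i', j) - \<delta>))
      - (f (P (i, j)) + f (P (i', j')) + f (P (i, j')) + f (P (i', j)))"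
proof -
  let ?K = "{(i, j), (i', j'), (i, j'), (i', j)}"
  have split: "(\<Sum>x\<in>B. g x) = (\<Sum>x\<in>B - ?K. g x) + (\<Sum>x\<in>?K. g x)" for g :: "nat \<times> nat \<Rightarrow> real"
    using assms(1,4) by (rule sum.subset_diff[rotated])
  have "(\<Sum>x\<in>B - ?K. f (move i j i' j' \<delta> P x)) = (\<Sum>x\<in>B - ?K. f (P x))"
    by (intro sum.cong) (auto simp: move_def)
  then show ?thesis
    unfolding split[of "\<lambda>x. f (P x)"] split[of "\<lambda>x. f (move i j i' j' \<delta> P x)"]
    using assms(2,3) by (simp add: move_def)
qed

lemma same_margins_move:
  assumes "finite I" "finite J" "i \<in> I" "i' \<in> I" "j \<in> J" "j' \<in> J" "i \<noteq> i'" "j \<noteq> j'"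
  shows "same_margins I J P (move i j i' j' \<delta> P)"
proof -
  have two: "(\<Sum>k\<in>K. g k) = (\<Sum>k\<in>K - {a, b}. g k) + (g a + g b)"
    if "finite K" "a \<in> K" "b \<in> K" "a \<noteq> b" for g :: "nat \<Rightarrow> real" and K a b
    using sum.subset_diff[of "{a, b}" K g] that by simp
  have "(\<Sum>k\<in>J. P (r, k)) = (\<Sum>k\<in>J. move i j i' j' \<delta> P (r, k))" for r
  proof -
    have "(\<Sum>k\<in>J - {j, j'}. move i j i' j' \<delta> P (r, k)) = (\<Sum>k\<in>J - {j, j'}. P (r, k))"
      by (intro sum.cong) (auto simp: move_def)
    then show ?thesis
      using assms by (simp add: two[of J j j'] move_def)
  qed
  moreover have "(\<Sum>k\<in>I. P (k, r)) = (\<Sum>k\<in>I. move i j i' j' \<delta> P (k, r))" for r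
  proof -
    have "(\<Sum>k\<in>I - {i, i'}. move i j i' j' \<delta> P (k, r)) = (\<Sum>k\<in>I - {i, i'}. P (k, r))"
      by (intro sum.cong) (auto simp: move_def)
    then show ?thesis
      using assms by (simp add: two[of I i i'] move_def)
  qed
  ultimately show ?thesis by (simp add: same_margins_def)
qed

text \<open>Induction on the number of nonzero entries in row \<open>i\<close> and column
  \<open>j\<close> other than \<open>(i, j)\<close>. Each move clears at least one of them, and the
  mass goes to \<open>(i, j)\<close> and to an entry off this cross. The set \<open>B\<close> may
  exceed the rectangle, so that \<open>spread\<close> always refers to the same set when rectangles
  shrink.\<close>

lemma concentrate:
  assumes fin: "finite I" "finite J" "finite B" and sub: "I \<times> J \<subseteq> B" and ij: "i \<in> I" "j \<in> J"
    and nonneg: "\<forall>x. 0 \<le> P x" and max: "\<forall>x\<in>I \<times> J. P x \<le> P (i, j)"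
  shows "\<exists>Q. (\<forall>x. 0 \<le> Q x) \<and> (\<forall>x. x \<notin> I \<times> J \<longrightarrow> Q x = P x) \<and> same_margins I J P Q \<and> spread B P Q
    \<and> ((\<forall>j'\<in>J - {j}. Q (i, j') = 0) \<or> (\<forall>i'\<in>I - {i}. Q (i', j) = 0))"
  using nonneg max
proof (induction "card {x \<in> {i} \<times> (J - {j}) \<union> (I - {i}) \<times> {j}. P x \<noteq> 0}" arbitrary: P rule: less_induct)
  case less
  note nonneg = less.prems(1) and max = less.prems(2)
  show ?case
  proof (cases "(\<forall>j'\<in>J - {j}. P (i, j') = 0) \<or> (\<forall>i'\<in>I - {i}. P (i', j) = 0)")
    case True
    then show ?thesis using nonneg by (intro exI[of _ P]) (simp add: same_margins_def)
  next
    case False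
    then obtain i' j' where i': "i' \<in> I" "i \<noteq> i'" and j': "j' \<in> J" "j \<noteq> j'"
      and nz: "P (i, j') \<noteq> 0" "P (i', j) \<noteq> 0" by blast
    \<comment> \<open>The largest shift that keeps both entries nonnegative; it empties one of
      them.\<close>
    define \<delta> where "\<delta> = min (P (i, j')) (P (i', j))"
    define R where "R = move i j i' j' \<delta> P"
    have \<delta>: "0 < \<delta>" "\<delta> \<le> P (i, j')" "\<delta> \<le> P (i', j)" "\<delta> = P (i, j') \<or> \<delta> = P (i', j)"
      using nz nonneg by (auto simp: \<delta>_def less_le)
    have le: "P (i, j') \<le> P (i, j)" "P (i', j) \<le> P (i, j)" "P (i', j') \<le> P (i, j)"
      using max i' j' ij by auto
    have R_nonneg: "\<forall>x. 0 \<le> R x"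
      using nonneg \<delta> by (simp add: R_def move_def add_nonneg_nonneg)
    \<comment> \<open>The only other entry that grows is \<open>(i', j')\<close>, and it gains
      exactly as much as \<open>(i, j)\<close>.\<close>
    have R_max: "\<forall>x\<in>I \<times> J. R x \<le> R (i, j)"
    proof
      fix x assume "x \<in> I \<times> J"
      then have "P x \<le> P (i, j)" using max by blast
      then show "R x \<le> R (i, j)" using \<delta>(1) le i' j' by (auto simp: R_def move_def)
    qed
    have R_off: "R x = P x" if "x \<notin> I \<times> J" for x
      using that ij i' j' by (auto simp: R_def move_def)
    have margins: "same_margins I J P R"
      unfolding R_def using fin ij i' j' by (intro same_margins_move) auto
    have K: "{(i, j), (i', j'), (i, j'), (i', j)} \<subseteq> B" using sub ij i' j' by auto
    have spread: "spread B P R"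
      unfolding spread_def
    proof (intro conjI allI disjI2)
      fix t
      show "(\<Sum>x\<in>B. hinge t (P x)) \<le> (\<Sum>x\<in>B. hinge t (R x))"
        using sum_move[OF fin(3) i'(2) j'(2) K, of "hinge t" \<delta> P]
          hinge_move[OF le \<delta>(4,2,3), of t] \<delta>(1) nonneg by (simp add: R_def)
    next
      show "(\<Sum>x\<in>B. (P x)\<^sup>2) < (\<Sum>x\<in>B. (R x)\<^sup>2)"
        using sum_move[OF fin(3) i'(2) j'(2) K, of power2 \<delta> P]
          square_move[OF le \<delta>(4,2,3,1)] nonneg by (simp add: R_def)
    qed
    let ?N = "\<lambda>P. {x \<in> {i} \<times> (J - {j}) \<union> (I - {i}) \<times> {j}. P x \<noteq> 0}"
    have "?N R \<subset> ?N P"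
    proof
      show "?N R \<subseteq> ?N P" using nz i' j' by (auto simp: R_def move_def split: if_splits)
      have "(i, j') \<in> ?N P - ?N R \<or> (i', j) \<in> ?N P - ?N R"
        using \<delta>(4) nz i' j' ij by (auto simp: R_def move_def)
      then show "?N R \<noteq> ?N P" by blast
    qed
    then have "card (?N R) < card (?N P)" using fin by (intro psubset_card_mono) auto
    from less.hyps[OF this R_nonneg R_max] obtain Q where
      "\<forall>x. 0 \<le> Q x" "\<forall>x. x \<notin> I \<times> J \<longrightarrow> Q x = R x" "same_margins I J R Q" "spread B R Q"
      "(\<forall>j'\<in>J - {j}. Q (i, j') = 0) \<or> (\<forall>i'\<in>I - {i}. Q (i', j) = 0)" by blast
    then show ?thesis
      using R_off margins spread_trans[OF spread]
      by (intro exI[of _ Q]) (auto simp: same_margins_def)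
  qed
qed


text \<open>Spanning trees of the complete bipartite graph between rows \<open>I\<close> and columns
  \<open>J\<close>, points being edges, grown by attaching one leaf vertex at a time. The inductions
  below peel leaves off in the reverse order.\<close>

inductive spanning_tree :: "nat set \<Rightarrow> nat set \<Rightarrow> (nat \<times> nat) set \<Rightarrow> bool" where
  single: "spanning_tree {i} {j} {(i, j)}"
| add_row: "spanning_tree I J T \<Longrightarrow> i \<notin> I \<Longrightarrow> j \<in> J \<Longrightarrow> spanning_tree (insert i I) J (insert (i, j) T)"
| add_col: "spanning_tree I J T \<Longrightarrow> i \<in> I \<Longrightarrow> j \<notin> J \<Longrightarrow> spanning_tree I (insert j J) (insert (i, j) T)"

lemma spanning_tree_insert_row:
  "spanning_tree (I - {i}) J T \<Longrightarrow> i \<in> I \<Longrightarrow> j \<in> J \<Longrightarrow> spanning_tree I J (insert (i, j) T)"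
  using add_row[of "I - {i}" J T i j] by (simp add: insert_absorb)

lemma spanning_tree_insert_col:
  "spanning_tree I (J - {j}) T \<Longrightarrow> i \<in> I \<Longrightarrow> j \<in> J \<Longrightarrow> spanning_tree I J (insert (i, j) T)"
  using add_col[of I "J - {j}" T i j] by (simp add: insert_absorb)

section \<open>Splitting off rows and columns\<close>

lemma same_margins_trans: "same_margins I J P Q \<Longrightarrow> same_margins I J Q R \<Longrightarrow> same_margins I J P R"
  by (simp add: same_margins_def)

text \<open>The untouched row keeps its own sum and contributes equally to each column sum.\<close>

lemma same_margins_extend_row:
  assumes "finite I" "i \<in> I" "same_margins (I - {i}) J P Q" "\<forall>j\<in>J. Q (i, j) = P (i, j)"
  shows "same_margins I J P Q"
  unfolding same_margins_def
proof (intro conjI ballI)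
  fix k assume "k \<in> I"
  then show "(\<Sum>j\<in>J. P (k, j)) = (\<Sum>j\<in>J. Q (k, j))"
    using assms(3,4) by (cases "k = i") (simp_all add: same_margins_def)
next
  fix j assume "j \<in> J"
  then show "(\<Sum>i\<in>I. P (i, j)) = (\<Sum>i\<in>I. Q (i, j))"
    using assms by (simp add: same_margins_def sum.remove[of I i])
qed

lemma same_margins_extend_col:
  assumes "finite J" "j \<in> J" "same_margins I (J - {j}) P Q" "\<forall>i\<in>I. Q (i, j) = P (i, j)"
  shows "same_margins I J P Q"
  unfolding same_margins_def
proof (intro conjI ballI)
  fix i assume "i \<in> I"
  then show "(\<Sum>j\<in>J. P (i, j)) = (\<Sum>j\<in>J. Q (i, j))"
    using assms by (simp add: same_margins_def sum.remove[of J j])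
next
  fix k assume "k \<in> J"
  then show "(\<Sum>i\<in>I. P (i, k)) = (\<Sum>i\<in>I. Q (i, k))"
    using assms(3,4) by (cases "k = j") (simp_all add: same_margins_def)
qed

text \<open>Induction on the number of rows plus columns. After \<open>concentrate\<close>, row
  \<open>i\<close> or column \<open>j\<close> has no nonzero entry except possibly at
  \<open>(i, j)\<close>, so it becomes a leaf attached there; the induction hypothesis treats the
  remaining rectangle.\<close>

lemma spread_onto_spanning_tree:
  assumes "finite I" "finite J" "I \<noteq> {}" "J \<noteq> {}" "finite B" "I \<times> J \<subseteq> B" "\<forall>x. 0 \<le> P x"
  shows "\<exists>Q T. (\<forall>x. 0 \<le> Q x) \<and> (\<forall>x. x \<notin> I \<times> J \<longrightarrow> Q x = P x) \<and> same_margins I J P Q \<and> spread B P Q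
    \<and> spanning_tree I J T \<and> {x \<in> I \<times> J. Q x \<noteq> 0} \<subseteq> T"
  using assms
proof (induction "card I + card J" arbitrary: I J P rule: less_induct)
  case less
  note fin = less.prems(1,2) and ne = less.prems(3,4) and finB = less.prems(5) and sub = less.prems(6)
  have "P ` (I \<times> J) \<noteq> {}" "finite (P ` (I \<times> J))" using fin ne by auto
  from Max_in[OF this(2,1)] obtain i j where ij: "i \<in> I" "j \<in> J" and "P (i, j) = Max (P ` (I \<times> J))"
    by auto
  then have max: "\<forall>x\<in>I \<times> J. P x \<le> P (i, j)" using fin by auto
  obtain R where R: "\<forall>x. 0 \<le> R x" "\<forall>x. x \<notin> I \<times> J \<longrightarrow> R x = P x" "same_margins I J P R" "spread B P R"
    and cross: "(\<forall>j'\<in>J - {j}. R (i, j') = 0) \<or> (\<forall>i'\<in>I - {i}. R (i', j) = 0)"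
    using concentrate[OF fin finB sub ij less.prems(7) max] by blast
  \<comment> \<open>If row \<open>i\<close> is clear but is the only row, then column
    \<open>j\<close> is vacuously clear; so either \<open>col\<close> applies or a single cell is
    left.\<close>
  consider (row) "\<forall>j'\<in>J - {j}. R (i, j') = 0" "I - {i} \<noteq> {}"
    | (col) "\<forall>i'\<in>I - {i}. R (i', j) = 0" "J - {j} \<noteq> {}"
    | (single) "I = {i}" "J = {j}"
    using cross ij by blast
  then show ?case
  proof cases
    case single
    then show ?thesis using R spanning_tree.single[of i j] by (intro exI[of _ R] exI[of _ "{(i, j)}"]) auto
  next
    case row
    have "card (I - {i}) < card I" using fin ij by (intro card_Diff1_less)
    then have "card (I - {i}) + card J < card I + card J" by simp
    moreover have "(I - {i}) \<times> J \<subseteq> B" using sub by blast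
    ultimately obtain Q T where Q: "\<forall>x. 0 \<le> Q x" "\<forall>x. x \<notin> (I - {i}) \<times> J \<longrightarrow> Q x = R x"
      "same_margins (I - {i}) J R Q" "spread B R Q"
      and T: "spanning_tree (I - {i}) J T" "{x \<in> (I - {i}) \<times> J. Q x \<noteq> 0} \<subseteq> T"
      using less.hyps[OF _ finite_Diff[OF fin(1)] fin(2) row(2) ne(2) finB _ R(1)] by blast
    have "same_margins I J R Q"
      by (rule same_margins_extend_row[OF fin(1) ij(1) Q(3)]) (simp add: Q(2))
    moreover have "{x \<in> I \<times> J. Q x \<noteq> 0} \<subseteq> insert (i, j) T"
    proof
      fix x assume x: "x \<in> {x \<in> I \<times> J. Q x \<noteq> 0}"
      show "x \<in> insert (i, j) T"
      proof (cases "fst x = i")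
        case True
        \<comment> \<open>Row \<open>i\<close> lies outside the smaller rectangle, where
          \<open>Q\<close> still agrees with \<open>R\<close>.\<close>
        then have "Q x = R x" "x = (i, snd x)" by (simp_all add: Q(2) mem_Times_iff prod_eq_iff)
        then show ?thesis using x row(1) by (cases x) auto
      next
        case False
        then show ?thesis using x T(2) by (auto simp: mem_Times_iff)
      qed
    qed
    moreover have "\<forall>x. x \<notin> I \<times> J \<longrightarrow> Q x = P x" using Q(2) R(2) by (metis DiffD1 SigmaE SigmaI)
    ultimately show ?thesis
      using Q(1) same_margins_trans[OF R(3)] spread_trans[OF R(4) Q(4)] spanning_tree_insert_row[OF T(1) ij]
      by blast
  next
    case col
    have "card (J - {j}) < card J" using fin ij by (intro card_Diff1_less)
    then have "card I + card (J - {j}) < card I + card J" by simp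
    moreover have "I \<times> (J - {j}) \<subseteq> B" using sub by blast
    ultimately obtain Q T where Q: "\<forall>x. 0 \<le> Q x" "\<forall>x. x \<notin> I \<times> (J - {j}) \<longrightarrow> Q x = R x"
      "same_margins I (J - {j}) R Q" "spread B R Q"
      and T: "spanning_tree I (J - {j}) T" "{x \<in> I \<times> (J - {j}). Q x \<noteq> 0} \<subseteq> T"
      using less.hyps[OF _ fin(1) finite_Diff[OF fin(2)] ne(1) col(2) finB _ R(1)] by blast
    have "same_margins I J R Q"
      by (rule same_margins_extend_col[OF fin(2) ij(2) Q(3)]) (simp add: Q(2))
    moreover have "{x \<in> I \<times> J. Q x \<noteq> 0} \<subseteq> insert (i, j) T"
    proof
      fix x assume x: "x \<in> {x \<in> I \<times> J. Q x \<noteq> 0}"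
      show "x \<in> insert (i, j) T"
      proof (cases "snd x = j")
        case True
        then have "Q x = R x" "x = (fst x, j)" by (simp_all add: Q(2) mem_Times_iff prod_eq_iff)
        then show ?thesis using x col(1) by (cases x) auto
      next
        case False
        then show ?thesis using x T(2) by (auto simp: mem_Times_iff)
      qed
    qed
    moreover have "\<forall>x. x \<notin> I \<times> J \<longrightarrow> Q x = P x" using Q(2) R(2) by (metis DiffD1 SigmaE SigmaI)
    ultimately show ?thesis
      using Q(1) same_margins_trans[OF R(3)] spread_trans[OF R(4) Q(4)] spanning_tree_insert_col[OF T(1) ij]
      by blast
  qed
qed

section \<open>Circuits and spanning trees\<close>

lemma spanning_tree_finite: "spanning_tree I J T \<Longrightarrow> finite I \<and> finite J"
  by (induction rule: spanning_tree.induct) auto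

lemma spanning_tree_subset: "spanning_tree I J T \<Longrightarrow> T \<subseteq> I \<times> J"
  by (induction rule: spanning_tree.induct) auto

lemma spanning_tree_covers: "spanning_tree I J T \<Longrightarrow> I \<subseteq> fst ` T \<and> J \<subseteq> snd ` T"
  by (induction rule: spanning_tree.induct) auto

text \<open>Each leaf brings one vertex and one new edge. \<open>Suc\<close> on the left avoids
  truncated subtraction.\<close>

lemma spanning_tree_card: "spanning_tree I J T \<Longrightarrow> Suc (card T) = card I + card J"
proof (induction rule: spanning_tree.induct)
  case (add_row I J T i j)
  have "finite T" "(i, j) \<notin> T"
    using spanning_tree_finite[OF add_row(1)] spanning_tree_subset[OF add_row(1)] add_row(2)
    by (auto intro: finite_subset)
  then show ?case using add_row spanning_tree_finite[OF add_row(1)] by simp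
next
  case (add_col I J T i j)
  have "finite T" "(i, j) \<notin> T"
    using spanning_tree_finite[OF add_col(1)] spanning_tree_subset[OF add_col(1)] add_col(3)
    by (auto intro: finite_subset)
  then show ?case using add_col spanning_tree_finite[OF add_col(1)] by simp
qed simp

lemma connected_pts_insert:
  assumes T: "connected_pts T" and b: "b \<in> T" "adjacent a b"
  shows "connected_pts (insert a T)"
proof -
  let ?r = "\<lambda>x y. x \<in> insert a T \<and> y \<in> insert a T \<and> adjacent x y"
  have mono: "?r\<^sup>*\<^sup>* x y" if "x \<in> T" "y \<in> T" for x y
  proof -
    have "(\<lambda>x y. x \<in> T \<and> y \<in> T \<and> adjacent x y)\<^sup>*\<^sup>* x y" using T that by (simp add: connected_pts_def)
    then show ?thesis by (rule rtranclp_mono[THEN predicate2D, rotated]) auto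
  qed
  have "?r a b" "?r b a" using b by (auto simp: adjacent_def)
  then have "?r\<^sup>*\<^sup>* a y" "?r\<^sup>*\<^sup>* y a" if "y \<in> T" for y
    using converse_rtranclp_into_rtranclp[of ?r a b, OF _ mono[OF b(1) that]]
      rtranclp.rtrancl_into_rtrancl[of ?r, OF mono[OF that b(1)]] by auto
  then show ?thesis using mono by (auto simp: connected_pts_def)
qed

text \<open>The tree meets every row and column, so a new leaf always shares its line with an older
  point.\<close>

lemma spanning_tree_connected: "spanning_tree I J T \<Longrightarrow> connected_pts T"
proof (induction rule: spanning_tree.induct)
  case (single i j)
  then show ?case by (simp add: connected_pts_def)
next
  case (add_row I J T i j)
  obtain k where "(k, j) \<in> T" using spanning_tree_covers[OF add_row(1)] add_row(3) by fastforce
  then show ?case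
    using add_row spanning_tree_subset[OF add_row(1)] by (intro connected_pts_insert[of _ "(k, j)"]) (auto simp: adjacent_def)
next
  case (add_col I J T i j)
  obtain k where "(i, k) \<in> T" using spanning_tree_covers[OF add_col(1)] add_col(2) by fastforce
  then show ?case
    using add_col spanning_tree_subset[OF add_col(1)] by (intro connected_pts_insert[of _ "(i, k)"]) (auto simp: adjacent_def)
qed

text \<open>The body of \<open>has_circuit\<close> with length and points exposed, so that a given
  circuit can be moved to another point set.\<close>

definition circuit_in :: "(nat \<times> nat) set \<Rightarrow> nat \<Rightarrow> (nat \<Rightarrow> nat \<times> nat) \<Rightarrow> bool" where
  "circuit_in T s v \<longleftrightarrow> s \<ge> 4 \<and> inj_on v {..<s} \<and> v ` {..<s} \<subseteq> T
     \<and> (\<forall>k<s. adjacent (v k) (v ((k + 1) mod s))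
        \<and> (int (fst (v ((k + 2) mod s))) - int (fst (v k)))
          * (int (snd (v ((k + 2) mod s))) - int (snd (v k))) \<noteq> 0)"

lemma has_circuit_iff: "has_circuit T \<longleftrightarrow> (\<exists>s v. circuit_in T s v)"
  unfolding has_circuit_def circuit_in_def by (rule refl)

lemma circuit_in_mono: "circuit_in S s v \<Longrightarrow> v ` {..<s} \<subseteq> T \<Longrightarrow> circuit_in T s v"
  by (simp add: circuit_in_def)

lemma circuit_in_subset: "circuit_in S s v \<Longrightarrow> v ` {..<s} \<subseteq> S"
  by (simp add: circuit_in_def)

lemma has_circuit_mono: "has_circuit S \<Longrightarrow> S \<subseteq> T \<Longrightarrow> has_circuit T"
  unfolding has_circuit_iff by (meson circuit_in_mono circuit_in_subset order_trans)

text \<open>The two neighbours of a point on a circuit differ in both coordinates, so one of them lies in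
  the row of the point and the other one in its column.\<close>

lemma circuit_point_not_leaf:
  assumes c: "circuit_in T s v" and k: "k < s"
  shows "(\<exists>y\<in>T. y \<noteq> v k \<and> fst y = fst (v k)) \<and> (\<exists>y\<in>T. y \<noteq> v k \<and> snd y = snd (v k))"
proof -
  \<comment> \<open>The cyclic predecessor of \<open>k\<close>; adding \<open>s\<close> first avoids
    truncated subtraction at \<open>k = 0\<close>.\<close>
  define l where "l = (k + s - 1) mod s"
  have l: "l < s" "(l + 1) mod s = k" "(l + 2) mod s = (k + 1) mod s"
  proof -
    show "l < s" using k by (simp add: l_def)
    show 1: "(l + 1) mod s = k" using k by (simp add: l_def mod_simps)
    have "(l + 2) mod s = ((l + 1) mod s + 1) mod s" by (simp add: mod_simps)
    then show "(l + 2) mod s = (k + 1) mod s" using 1 by simp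
  qed
  have step: "adjacent (v a) (v ((a + 1) mod s))" "fst (v ((a + 2) mod s)) \<noteq> fst (v a)"
    "snd (v ((a + 2) mod s)) \<noteq> snd (v a)" if "a < s" for a
    using c that unfolding circuit_in_def by auto
  have "adjacent (v l) (v k)" "adjacent (v k) (v ((k + 1) mod s))"
    "fst (v ((k + 1) mod s)) \<noteq> fst (v l)" "snd (v ((k + 1) mod s)) \<noteq> snd (v l)"
    using step[OF l(1)] step(1)[OF k] l by simp_all
  moreover have "v l \<in> T" "v ((k + 1) mod s) \<in> T" using circuit_in_subset[OF c] l by auto
  ultimately show ?thesis unfolding adjacent_def by metis
qed

text \<open>A point alone in its row or in its column lies on no circuit, so the circuit already
  lives in \<open>T\<close>.\<close>

lemma has_circuit_insert_leaf:
  assumes c: "has_circuit (insert x T)"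
    and leaf: "(\<forall>y\<in>T. y \<noteq> x \<longrightarrow> fst y \<noteq> fst x) \<or> (\<forall>y\<in>T. y \<noteq> x \<longrightarrow> snd y \<noteq> snd x)"
  shows "has_circuit T"
proof -
  obtain s v where v: "circuit_in (insert x T) s v"
    using c unfolding has_circuit_iff by blast
  have "x \<notin> v ` {..<s}"
  proof
    assume "x \<in> v ` {..<s}"
    then obtain k where "k < s" "x = v k" by blast
    then show False using circuit_point_not_leaf[OF v, of k] leaf by (metis insertE)
  qed
  then have "v ` {..<s} \<subseteq> T" using circuit_in_subset[OF v] by blast
  then show ?thesis using circuit_in_mono[OF v] unfolding has_circuit_iff by blast
qed

lemma no_circuit_empty: "\<not> has_circuit {}"
  by (auto simp: has_circuit_iff circuit_in_def lessThan_empty_iff)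

lemma spanning_tree_no_circuit: "spanning_tree I J T \<Longrightarrow> \<not> has_circuit T"
proof (induction rule: spanning_tree.induct)
  case (single i j)
  then show ?case using has_circuit_insert_leaf[of "(i, j)" "{}"] no_circuit_empty by auto
next
  case (add_row I J T i j)
  then have "\<forall>y\<in>T. fst y \<noteq> i" using spanning_tree_subset[OF add_row(1)] by auto
  then show ?case using has_circuit_insert_leaf[of "(i, j)" T] add_row.IH by auto
next
  case (add_col I J T i j)
  then have "\<forall>y\<in>T. snd y \<noteq> j" using spanning_tree_subset[OF add_col(1)] by auto
  then show ?case using has_circuit_insert_leaf[of "(i, j)" T] add_col.IH by auto
qed

section \<open>Cycles in the bipartite graph of a point set\<close>

text \<open>A point (i, j) is viewed as an edge between the row vertex \<open>Inl i\<close> and the column vertex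
  \<open>Inr j\<close>.\<close>

definition edges :: "(nat \<times> nat) set \<Rightarrow> ((nat + nat) \<times> (nat + nat)) set" where
  "edges S = {(Inl i, Inr j) | i j. (i, j) \<in> S} \<union> {(Inr j, Inl i) | i j. (i, j) \<in> S}"

text \<open>Recovers the point from an edge traversed in either direction.\<close>

definition pt :: "nat + nat \<Rightarrow> nat + nat \<Rightarrow> nat \<times> nat" where
  "pt a b = (if isl a then (projl a, projr b) else (projl b, projr a))"

text \<open>The bound 3 rules out running back and forth along one edge; bipartiteness then forces
  length at least 4.\<close>

definition graph_cycle :: "(nat \<times> nat) set \<Rightarrow> nat \<Rightarrow> (nat \<Rightarrow> nat + nat) \<Rightarrow> bool" where
  "graph_cycle S s w \<longleftrightarrow> 3 \<le> s \<and> inj_on w {..<s} \<and> (\<forall>k<s. (w k, w (Suc k mod s)) \<in> edges S)"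

lemma graph_cycle_mono: "graph_cycle S s w \<Longrightarrow> S \<subseteq> T \<Longrightarrow> graph_cycle T s w"
  unfolding graph_cycle_def edges_def by blast

text \<open>The first vertex of a longest path has a second predecessor, which must lie on the path.\<close>

lemma cycle_exists:
  assumes "finite V" "V \<noteq> {}" "irrefl E" and pred: "\<And>x z. x \<in> V \<Longrightarrow> \<exists>y\<in>V. (y, x) \<in> E \<and> y \<noteq> z"
  shows "\<exists>s w. 3 \<le> s \<and> inj_on w {..<s} \<and> (\<forall>k<s. (w k, w (Suc k mod s)) \<in> E)"
proof -
  define path where "path xs \<longleftrightarrow> xs \<noteq> [] \<and> distinct xs \<and> set xs \<subseteq> V
    \<and> (\<forall>k. Suc k < length xs \<longrightarrow> (xs ! k, xs ! Suc k) \<in> E)" for xs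
  obtain x where "x \<in> V" using assms(2) by blast
  then have "path [x]" by (simp add: path_def)
  moreover have "\<forall>ys. path ys \<longrightarrow> length ys < Suc (card V)"
    using card_mono[OF assms(1)] by (metis distinct_card path_def less_Suc_eq_le)
  ultimately have "\<exists>xs. path xs \<and> (\<forall>ys. path ys \<longrightarrow> length ys \<le> length xs)"
    by (rule ex_has_greatest_nat)
  then obtain xs where xs: "path xs" and longest: "\<And>ys. path ys \<Longrightarrow> length ys \<le> length xs"
    by blast
  \<comment> \<open>Avoiding \<open>xs ! 1\<close> prevents a closed walk of length two. On a
    one-vertex path this value is unspecified, which is harmless because \<open>pred\<close> allows
    any \<open>z\<close>.\<close>
  have "xs ! 0 \<in> V" using xs unfolding path_def by (metis length_greater_0_conv nth_mem subsetD)
  then obtain y where y: "y \<in> V" "(y, xs ! 0) \<in> E" "y \<noteq> xs ! 1" using pred by blast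
  have "y \<in> set xs"
  proof (rule ccontr)
    assume "y \<notin> set xs"
    then have "path (y # xs)"
      using xs y unfolding path_def by (auto simp: nth_Cons split: nat.split)
    then show False using longest by fastforce
  qed
  then obtain k where k: "k < length xs" "y = xs ! k" by (metis in_set_conv_nth)
  have "k \<noteq> 0" using y(2) k(2) assms(3) by (metis irreflD)
  moreover have "k \<noteq> 1" using y(3) k(2) by auto
  ultimately have "3 \<le> Suc k" by simp
  moreover have "inj_on ((!) xs) {..<Suc k}"
    using xs k(1) by (auto simp: path_def inj_on_def nth_eq_iff_index_eq)
  moreover have "(xs ! l, xs ! (Suc l mod Suc k)) \<in> E" if "l < Suc k" for l
    using xs k y(2) that unfolding path_def by (cases "l = k") auto
  ultimately show ?thesis by (intro exI[of _ "Suc k"] exI[of _ "(!) xs"]) simp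
qed

text \<open>Every vertex has two distinct neighbours, hence one that differs from any prescribed
  \<open>z\<close>.\<close>

lemma leafless_has_cycle:
  assumes "finite S" "S \<noteq> {}"
    and leafless: "\<And>i j. (i, j) \<in> S \<Longrightarrow> (\<exists>j'. j' \<noteq> j \<and> (i, j') \<in> S) \<and> (\<exists>i'. i' \<noteq> i \<and> (i', j) \<in> S)"
  shows "\<exists>s w. graph_cycle S s w"
  unfolding graph_cycle_def
proof (rule cycle_exists)
  let ?V = "Inl ` fst ` S \<union> Inr ` snd ` S :: (nat + nat) set"
  show "finite ?V" "?V \<noteq> {}" using assms by auto
  show "irrefl (edges S)" by (auto simp: irrefl_def edges_def)
  show "\<exists>y\<in>?V. (y, x) \<in> edges S \<and> y \<noteq> z" if x: "x \<in> ?V" for x z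
  proof (cases x)
    case (Inl i)
    then obtain j where "(i, j) \<in> S" using x by auto
    moreover then obtain j' where "j' \<noteq> j" "(i, j') \<in> S" using leafless by blast
    moreover have "Inr j \<noteq> z \<or> Inr j' \<noteq> z" using \<open>j' \<noteq> j\<close> by blast
    ultimately show ?thesis using Inl unfolding edges_def by force
  next
    case (Inr j)
    then obtain i where "(i, j) \<in> S" using x by auto
    moreover then obtain i' where "i' \<noteq> i" "(i', j) \<in> S" using leafless by blast
    moreover have "Inl i \<noteq> z \<or> Inl i' \<noteq> z" using \<open>i' \<noteq> i\<close> by blast
    ultimately show ?thesis using Inr unfolding edges_def by force
  qed
qed

lemma edge_pt: "(a, b) \<in> edges S \<Longrightarrow> pt a b \<in> S \<and> isl b \<noteq> isl a"
  by (auto simp: edges_def pt_def)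

text \<open>Along a path \<open>a\<close>, \<open>b\<close>, \<open>c\<close>, \<open>d\<close>,
  neighbouring edges share a vertex, that is a row or a column. Since \<open>a\<close>,
  \<open>c\<close> lie on one side and \<open>b\<close>, \<open>d\<close> on the other, the outer
  edges differ in both coordinates.\<close>

lemma edges_consecutive:
  assumes "(a, b) \<in> edges S" "(b, c) \<in> edges S" "(c, d) \<in> edges S" "a \<noteq> c" "b \<noteq> d"
  shows "adjacent (pt a b) (pt b c) \<and> fst (pt c d) \<noteq> fst (pt a b) \<and> snd (pt c d) \<noteq> snd (pt a b)"
  using assms by (auto simp: edges_def pt_def adjacent_def)

lemma pt_eq:
  assumes "(a, b) \<in> edges S" "(c, d) \<in> edges S" "pt a b = pt c d"
  shows "a = c \<and> b = d \<or> a = d \<and> b = c"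
  using assms by (auto simp: edges_def pt_def)

text \<open>Equal points are the same edge. Traversing it in opposite directions would make
  \<open>k\<close> and \<open>l\<close> cyclic successors of each other, impossible for length at
  least 3.\<close>

lemma inj_on_cycle_pt:
  assumes "graph_cycle S s w"
  shows "inj_on (\<lambda>k. pt (w k) (w (Suc k mod s))) {..<s}"
proof (rule inj_onI)
  fix k l assume kl: "k \<in> {..<s}" "l \<in> {..<s}"
    and eq: "pt (w k) (w (Suc k mod s)) = pt (w l) (w (Suc l mod s))"
  have s: "3 \<le> s" and inj: "inj_on w {..<s}" using assms by (auto simp: graph_cycle_def)
  have m: "Suc k mod s < s" "Suc l mod s < s" using s by auto
  have "w k = w l \<or> w k = w (Suc l mod s) \<and> w (Suc k mod s) = w l"
    using pt_eq[OF _ _ eq] assms kl unfolding graph_cycle_def by blast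
  then have "k = l \<or> k = Suc l mod s \<and> Suc k mod s = l"
    using inj kl m unfolding inj_on_def by (metis lessThan_iff)
  then show "k = l" using s kl by (auto simp: mod_Suc split: if_splits)
qed

lemma graph_cycle_has_circuit:
  assumes "graph_cycle S s w"
  shows "has_circuit S"
proof -
  have s: "3 \<le> s" and inj: "inj_on w {..<s}" and e: "\<And>k. k < s \<Longrightarrow> (w k, w (Suc k mod s)) \<in> edges S"
    using assms unfolding graph_cycle_def by blast+
  \<comment> \<open>Rows and columns alternate along the cycle, so it cannot close after three
    steps.\<close>
  have "s \<noteq> 3"
  proof
    assume "s = 3"
    then have "(w 0, w 1) \<in> edges S" "(w 1, w 2) \<in> edges S" "(w 2, w 0) \<in> edges S"
      using e[of 0] e[of 1] e[of 2] by (simp_all add: numeral_2_eq_2)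
    then show False using edge_pt by blast
  qed
  then have "4 \<le> s" using s by simp
  define v where "v k = pt (w k) (w (Suc k mod s))" for k
  have circ: "adjacent (v k) (v ((k + 1) mod s)) \<and> fst (v ((k + 2) mod s)) \<noteq> fst (v k)
    \<and> snd (v ((k + 2) mod s)) \<noteq> snd (v k)" if k: "k < s" for k
  proof -
    let ?b = "Suc k mod s" and ?c = "(k + 2) mod s" and ?d = "(k + 3) mod s"
    have lt: "?b < s" "?c < s" "?d < s" using s by auto
    have eqs: "Suc ?b mod s = ?c" "Suc ?c mod s = ?d" by (simp_all add: mod_Suc_eq numeral_3_eq_3)
    have "k \<noteq> ?c" using s k by (auto simp: mod_if)
    then have "w k \<noteq> w ?c" using inj k lt by (auto simp: inj_on_def)
    moreover have "?b \<noteq> ?d" using s k by (auto simp: mod_if)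
    then have "w ?b \<noteq> w ?d" using inj lt by (auto simp: inj_on_def)
    ultimately show ?thesis
      using edges_consecutive[OF e[OF k] e[OF lt(1), unfolded eqs] e[OF lt(2), unfolded eqs]] eqs
      by (simp add: v_def)
  qed
  have "v ` {..<s} \<subseteq> S" using edge_pt[OF e] by (auto simp: v_def)
  moreover have "inj_on v {..<s}" using inj_on_cycle_pt[OF assms] by (simp add: v_def[abs_def])
  ultimately have "circuit_in S s v"
    unfolding circuit_in_def using \<open>4 \<le> s\<close> circ by (simp add: of_nat_eq_iff)
  then show ?thesis unfolding has_circuit_iff by blast
qed

section \<open>Matrices with zero margins\<close>

lemma sum_cyclic_shift: "(\<Sum>k<s. g (Suc k mod s)) = (\<Sum>k<s. g k)"
proof (cases s)
  case (Suc r)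
  have "(\<Sum>k<r. g (Suc k mod Suc r)) = (\<Sum>k<r. g (Suc k))" by (intro sum.cong) auto
  then have "(\<Sum>k<s. g (Suc k mod s)) = g 0 + (\<Sum>k<r. g (Suc k))" unfolding Suc by (simp add: add.commute)
  also have "\<dots> = (\<Sum>k<s. g k)" unfolding Suc by (rule sum.lessThan_Suc_shift[symmetric])
  finally show ?thesis .
qed simp

lemma graph_cycle_kernel:
  assumes c: "graph_cycle S s w" and S: "S \<subseteq> I \<times> J" and fin: "finite I" "finite J"
  shows "\<exists>D. D \<noteq> (\<lambda>_. 0) \<and> (\<forall>x. x \<notin> S \<longrightarrow> D x = 0) \<and> same_margins I J D (\<lambda>_. 0)"
proof -
  have s: "3 \<le> s" and e: "\<And>k. k < s \<Longrightarrow> (w k, w (Suc k mod s)) \<in> edges S"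
    using c by (auto simp: graph_cycle_def)
  \<comment> \<open>The sign is positive on edges leaving a row and negative on edges leaving a
    column, so it alternates along the cycle.\<close>
  define \<sigma> :: "nat + nat \<Rightarrow> real" where "\<sigma> a = (if isl a then 1 else -1)" for a
  define v where "v k = pt (w k) (w (Suc k mod s))" for k
  define D where "D x = (\<Sum>k<s. if v k = x then \<sigma> (w k) else 0)" for x
  have vS: "v k \<in> S" if "k < s" for k using edge_pt[OF e[OF that]] by (simp add: v_def)
  have inj: "inj_on v {..<s}" using inj_on_cycle_pt[OF c] by (simp add: v_def[abs_def])
  have "D (v 0) = (\<Sum>k<s. if k = 0 then \<sigma> (w 0) else 0)"
    unfolding D_def using s by (intro sum.cong) (auto simp: inj_on_eq_iff[OF inj])
  then have "D (v 0) \<noteq> 0" using s by (simp add: \<sigma>_def)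
  then have "D \<noteq> (\<lambda>_. 0)" by metis
  moreover have "D x = 0" if "x \<notin> S" for x
    unfolding D_def using vS that by (intro sum.neutral) auto
  moreover have "same_margins I J D (\<lambda>_. 0)"
    unfolding same_margins_def
  proof (intro conjI ballI)
    fix i assume "i \<in> I"
    have "(\<Sum>j\<in>J. D (i, j)) = (\<Sum>k<s. \<Sum>j\<in>J. if v k = (i, j) then \<sigma> (w k) else 0)"
      unfolding D_def by (rule sum.swap)
    \<comment> \<open>An edge counts +1 when it leaves row \<open>i\<close> and -1 when it enters
      it; around the cycle these cancel by a cyclic shift. For columns the signs are
      reversed.\<close>
    also have "\<dots> = (\<Sum>k<s. of_bool (w k = Inl i) - of_bool (w (Suc k mod s) = Inl i))"
    proof (intro sum.cong refl)
      fix k assume k: "k \<in> {..<s}"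
      have "snd (v k) \<in> J" using vS[of k] S k by auto
      have "(\<Sum>j\<in>J. if v k = (i, j) then \<sigma> (w k) else 0)
          = (\<Sum>j\<in>J. if snd (v k) = j then (if fst (v k) = i then \<sigma> (w k) else 0) else 0)"
        by (intro sum.cong) (auto simp: prod_eq_iff)
      also have "\<dots> = (if fst (v k) = i then \<sigma> (w k) else 0)"
        using fin \<open>snd (v k) \<in> J\<close> by simp
      also have "\<dots> = of_bool (w k = Inl i) - of_bool (w (Suc k mod s) = Inl i)"
        using e[of k] k by (auto simp: edges_def v_def pt_def \<sigma>_def)
      finally show "(\<Sum>j\<in>J. if v k = (i, j) then \<sigma> (w k) else 0)
        = of_bool (w k = Inl i) - of_bool (w (Suc k mod s) = Inl i)" .
    qed
    also have "\<dots> = 0"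
      using sum_cyclic_shift[of "\<lambda>k. of_bool (w k = Inl i) :: real" s] by (simp add: sum_subtractf)
    finally show "(\<Sum>j\<in>J. D (i, j)) = (\<Sum>j\<in>J. 0)" by simp
  next
    fix j assume "j \<in> J"
    have "(\<Sum>i\<in>I. D (i, j)) = (\<Sum>k<s. \<Sum>i\<in>I. if v k = (i, j) then \<sigma> (w k) else 0)"
      unfolding D_def by (rule sum.swap)
    also have "\<dots> = (\<Sum>k<s. of_bool (w (Suc k mod s) = Inr j) - of_bool (w k = Inr j))"
    proof (intro sum.cong refl)
      fix k assume k: "k \<in> {..<s}"
      have "fst (v k) \<in> I" using vS[of k] S k by auto
      have "(\<Sum>i\<in>I. if v k = (i, j) then \<sigma> (w k) else 0)
          = (\<Sum>i\<in>I. if fst (v k) = i then (if snd (v k) = j then \<sigma> (w k) else 0) else 0)"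
        by (intro sum.cong) (auto simp: prod_eq_iff)
      also have "\<dots> = (if snd (v k) = j then \<sigma> (w k) else 0)"
        using fin \<open>fst (v k) \<in> I\<close> by simp
      also have "\<dots> = of_bool (w (Suc k mod s) = Inr j) - of_bool (w k = Inr j)"
        using e[of k] k by (auto simp: edges_def v_def pt_def \<sigma>_def)
      finally show "(\<Sum>i\<in>I. if v k = (i, j) then \<sigma> (w k) else 0)
        = of_bool (w (Suc k mod s) = Inr j) - of_bool (w k = Inr j)" .
    qed
    also have "\<dots> = 0"
      using sum_cyclic_shift[of "\<lambda>k. of_bool (w k = Inr j) :: real" s] by (simp add: sum_subtractf)
    finally show "(\<Sum>i\<in>I. D (i, j)) = (\<Sum>i\<in>I. 0)" by simp
  qed
  ultimately show ?thesis by (intro exI[of _ D] conjI allI impI)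
qed

text \<open>A nonzero entry alone in its row or column would be a nonzero margin. So the support of
  a nonzero \<open>D\<close> is leafless, contains a cycle and hence a circuit of
  \<open>T\<close>.\<close>

lemma kernel_zero:
  assumes T: "\<not> has_circuit T" "T \<subseteq> I \<times> J" and fin: "finite I" "finite J"
    and D: "\<forall>x. x \<notin> T \<longrightarrow> D x = 0" "same_margins I J D (\<lambda>_. 0)"
  shows "D = (\<lambda>_. 0)"
proof (rule ccontr)
  assume "D \<noteq> (\<lambda>_. 0)"
  define S where "S = {x. D x \<noteq> 0}"
  have "S \<noteq> {}" using \<open>D \<noteq> (\<lambda>_. 0)\<close> by (auto simp: S_def)
  have "S \<subseteq> T" using D(1) by (auto simp: S_def)
  then have "finite S" using T(2) fin by (meson finite_SigmaI finite_subset)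
  have "\<exists>s w. graph_cycle S s w"
  proof (rule leafless_has_cycle[OF \<open>finite S\<close> \<open>S \<noteq> {}\<close>], intro conjI)
    fix i j assume ij: "(i, j) \<in> S"
    then have I: "i \<in> I" "j \<in> J" using \<open>S \<subseteq> T\<close> T(2) by auto
    show "\<exists>j'. j' \<noteq> j \<and> (i, j') \<in> S"
    proof (rule ccontr)
      assume "\<nexists>j'. j' \<noteq> j \<and> (i, j') \<in> S"
      then have "(\<Sum>k\<in>J. D (i, k)) = D (i, j)" using fin I
        by (subst sum.remove[of J j]) (auto simp: S_def intro!: sum.neutral)
      then show False using D(2) I ij by (simp add: same_margins_def S_def)
    qed
    show "\<exists>i'. i' \<noteq> i \<and> (i', j) \<in> S"
    proof (rule ccontr)
      assume "\<nexists>i'. i' \<noteq> i \<and> (i', j) \<in> S"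
      then have "(\<Sum>k\<in>I. D (k, j)) = D (i, j)" using fin I
        by (subst sum.remove[of I i]) (auto simp: S_def intro!: sum.neutral)
      then show False using D(2) I ij by (simp add: same_margins_def S_def)
    qed
  qed
  then show False using graph_cycle_has_circuit has_circuit_mono[OF _ \<open>S \<subseteq> T\<close>] T(1) by blast
qed

text \<open>An acyclic set leaves some row or column with at most one point; remove that line,
  extend the rest inductively and reattach it as a leaf.\<close>

lemma extend_to_spanning_tree:
  assumes "finite I" "finite J" "I \<noteq> {}" "J \<noteq> {}" "S \<subseteq> I \<times> J" "\<nexists>s w. graph_cycle S s w"
  shows "\<exists>T. S \<subseteq> T \<and> spanning_tree I J T"
  using assms
proof (induction "card I + card J" arbitrary: I J S rule: less_induct)
  case less
  note fin = less.prems(1,2) and ne = less.prems(3,4) and sub = less.prems(5) and acyc = less.prems(6)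
  have "finite S" using fin sub by (meson finite_SigmaI finite_subset)
  \<comment> \<open>The position \<open>(i, j)\<close> need not belong to \<open>S\<close>: for a
    line without points of \<open>S\<close> any partner will do.\<close>
  have "\<exists>i\<in>I. \<exists>j\<in>J. (\<forall>j'. (i, j') \<in> S \<longrightarrow> j' = j) \<or> (\<forall>i'. (i', j) \<in> S \<longrightarrow> i' = i)"
  proof (rule ccontr)
    assume no_leaf: "\<not> ?thesis"
    then have "S \<noteq> {}" using ne by blast
    have "\<exists>s w. graph_cycle S s w"
    proof (rule leafless_has_cycle[OF \<open>finite S\<close> \<open>S \<noteq> {}\<close>])
      fix i j assume "(i, j) \<in> S"
      then have "i \<in> I" "j \<in> J" using sub by auto
      then show "(\<exists>j'. j' \<noteq> j \<and> (i, j') \<in> S) \<and> (\<exists>i'. i' \<noteq> i \<and> (i', j) \<in> S)"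
        using no_leaf by blast
    qed
    then show False using acyc by blast
  qed
  then obtain i j where ij: "i \<in> I" "j \<in> J"
    and leaf: "(\<forall>j'. (i, j') \<in> S \<longrightarrow> j' = j) \<or> (\<forall>i'. (i', j) \<in> S \<longrightarrow> i' = i)"
    by blast
  have acyc': "\<nexists>s w. graph_cycle R s w" if "R \<subseteq> S" for R
    using acyc graph_cycle_mono[OF _ that] by blast
  consider (row) "\<forall>j'. (i, j') \<in> S \<longrightarrow> j' = j" "I - {i} \<noteq> {}"
    | (col) "\<forall>i'. (i', j) \<in> S \<longrightarrow> i' = i" "J - {j} \<noteq> {}"
    | (single) "I = {i}" "J = {j}"
    using leaf ij sub by blast
  then show ?case
  proof cases
    case single
    then show ?thesis using sub spanning_tree.single[of i j] by (intro exI[of _ "{(i, j)}"]) auto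
  next
    case row
    have "card (I - {i}) < card I" using fin ij by (intro card_Diff1_less)
    then have "card (I - {i}) + card J < card I + card J" by simp
    from less.hyps[OF this finite_Diff[OF fin(1)] fin(2) row(2) ne(2) _ acyc', of "S \<inter> ((I - {i}) \<times> J)"]
    obtain T where T: "S \<inter> ((I - {i}) \<times> J) \<subseteq> T" "spanning_tree (I - {i}) J T" by blast
    have "S \<subseteq> insert (i, j) T" using T(1) row(1) sub by blast
    then show ?thesis using spanning_tree_insert_row[OF T(2) ij] by blast
  next
    case col
    have "card (J - {j}) < card J" using fin ij by (intro card_Diff1_less)
    then have "card I + card (J - {j}) < card I + card J" by simp
    from less.hyps[OF this fin(1) finite_Diff[OF fin(2)] ne(1) col(2) _ acyc', of "S \<inter> (I \<times> (J - {j}))"]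
    obtain T where T: "S \<inter> (I \<times> (J - {j})) \<subseteq> T" "spanning_tree I (J - {j}) T" by blast
    have "S \<subseteq> insert (i, j) T" using T(1) col(1) sub by blast
    then show ?thesis using spanning_tree_insert_col[OF T(2) ij] by blast
  qed
qed

section \<open>Extreme points and minimizers\<close>

lemma transport_polytope_sums:
  assumes "P \<in> \<C> m n p q"
  shows "i \<in> {1..m} \<Longrightarrow> (\<Sum>j=1..n. P (i, j)) = p i" and "j \<in> {1..n} \<Longrightarrow> (\<Sum>i=1..m. P (i, j)) = q j"
  using assms unfolding transport_polytope_def by blast+

lemma transport_polytope_same_margins:
  assumes "P \<in> \<C> m n p q" "Q \<in> \<C> m n p q"
  shows "same_margins {1..m} {1..n} P Q"
  unfolding same_margins_def
  using transport_polytope_sums[OF assms(1)] transport_polytope_sums[OF assms(2)] by simp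

lemma transport_polytope_nonneg: "P \<in> \<C> m n p q \<Longrightarrow> 0 \<le> P x"
  unfolding transport_polytope_def by blast

lemma transport_polytope_off_supp: "P \<in> \<C> m n p q \<Longrightarrow> x \<notin> supp_mat m n P \<Longrightarrow> P x = 0"
  unfolding transport_polytope_def supp_mat_def by blast

lemma transport_polytope_off_box: "P \<in> \<C> m n p q \<Longrightarrow> x \<notin> box m n \<Longrightarrow> P x = 0"
  unfolding transport_polytope_def by blast

lemma transport_polytopeI:
  assumes P: "P \<in> \<C> m n p q" and Q: "\<forall>x. 0 \<le> Q x" "\<forall>x. x \<notin> box m n \<longrightarrow> Q x = 0"
    and "same_margins {1..m} {1..n} P Q"
  shows "Q \<in> \<C> m n p q"
proof -
  have "(\<Sum>j=1..n. Q (i, j)) = p i" if "i \<in> {1..m}" for i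
    using assms(4) transport_polytope_sums(1)[OF P that] that unfolding same_margins_def by metis
  moreover have "(\<Sum>i=1..m. Q (i, j)) = q j" if "j \<in> {1..n}" for j
    using assms(4) transport_polytope_sums(2)[OF P that] that unfolding same_margins_def by metis
  ultimately show ?thesis using Q unfolding transport_polytope_def by blast
qed

lemma same_margins_diff:
  "same_margins I J P Q \<Longrightarrow> same_margins I J (\<lambda>x. P x - Q x) (\<lambda>_. 0)"
  by (simp add: same_margins_def sum_subtractf)

section \<open>Points supported on trees\<close>

lemma tree_polytope_ptsI:
  assumes P: "P \<in> \<C> m n p q" and T: "spanning_tree {1..m} {1..n} T" and sub: "supp_mat m n P \<subseteq> T"
  shows "P \<in> tree_polytope_pts m n p q"
proof -
  have "card T = m + n - 1" using spanning_tree_card[OF T] by simp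
  then show ?thesis
    using P sub spanning_tree_subset[OF T] spanning_tree_connected[OF T] spanning_tree_no_circuit[OF T]
    unfolding tree_polytope_pts_def is_tree_def box_def by blast
qed

lemma spread_into_tree_polytope_pts:
  assumes P: "P \<in> \<C> m n p q" and mn: "1 \<le> m" "1 \<le> n"
  shows "\<exists>Q\<in>tree_polytope_pts m n p q. spread (box m n) P Q"
proof -
  have "\<forall>x. 0 \<le> P x" using transport_polytope_nonneg[OF P] by blast
  then obtain Q T where Q: "\<forall>x. 0 \<le> Q x" "\<forall>x. x \<notin> box m n \<longrightarrow> Q x = P x"
      "same_margins {1..m} {1..n} P Q" "spread (box m n) P Q"
    and T: "spanning_tree {1..m} {1..n} T" "{x \<in> box m n. Q x \<noteq> 0} \<subseteq> T"
    using spread_onto_spanning_tree[of "{1..m}" "{1..n}" "box m n" P] mn by (auto simp: box_def)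
  have "Q \<in> \<C> m n p q"
  proof (rule transport_polytopeI[OF P Q(1) _ Q(3)])
    show "\<forall>x. x \<notin> box m n \<longrightarrow> Q x = 0"
      using Q(2) transport_polytope_off_box[OF P] by metis
  qed
  then show ?thesis using tree_polytope_ptsI T Q(4) unfolding supp_mat_def by blast
qed

text \<open>The difference of the two matrices has zero margins and lives on \<open>T\<close>, so
  \<open>kernel_zero\<close> applies.\<close>

lemma circuit_free_support_unique:
  assumes P: "P \<in> \<C> m n p q" and Q: "Q \<in> \<C> m n p q" and T: "\<not> has_circuit T" "T \<subseteq> box m n"
    and sub: "supp_mat m n P \<subseteq> T" "supp_mat m n Q \<subseteq> T"
  shows "P = Q"
proof -
  have "P x = 0" if "x \<notin> T" for x
    by (rule transport_polytope_off_supp[OF P]) (use sub that in blast)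
  moreover have "Q x = 0" if "x \<notin> T" for x
    by (rule transport_polytope_off_supp[OF Q]) (use sub that in blast)
  ultimately have off: "\<forall>x. x \<notin> T \<longrightarrow> P x - Q x = 0" by simp
  have "(\<lambda>x. P x - Q x) = (\<lambda>_. 0)"
    by (rule kernel_zero[OF T[unfolded box_def] finite_atLeastAtMost finite_atLeastAtMost off
        same_margins_diff[OF transport_polytope_same_margins[OF P Q]]])
  then show ?thesis by (simp add: fun_eq_iff)
qed

text \<open>A tree point is determined by its support, and the box has finitely many
  subsets.\<close>

lemma finite_tree_polytope_pts: "finite (tree_polytope_pts m n p q)"
proof (rule finite_imageD)
  show "finite (supp_mat m n ` tree_polytope_pts m n p q)"
    by (rule finite_subset[of _ "Pow (box m n)"]) (auto simp: supp_mat_def)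
  show "inj_on (supp_mat m n) (tree_polytope_pts m n p q)"
  proof (rule inj_onI)
    fix P Q assume PQ: "P \<in> tree_polytope_pts m n p q" "Q \<in> tree_polytope_pts m n p q"
      and eq: "supp_mat m n P = supp_mat m n Q"
    from PQ(1) obtain T where "\<not> has_circuit T" "T \<subseteq> box m n" "supp_mat m n P \<subseteq> T"
      unfolding tree_polytope_pts_def is_tree_def by blast
    then show "P = Q"
      using circuit_free_support_unique[of P m n p q Q T] PQ eq by (simp add: tree_polytope_pts_def)
  qed
qed

text \<open>With positive weights and nonnegative entries, both ends of a segment through
  \<open>P\<close> vanish wherever \<open>P\<close> does; so both are supported on \<open>T\<close>
  and coincide.\<close>

lemma tree_polytope_pts_extreme:
  assumes "P \<in> tree_polytope_pts m n p q"
  shows "P \<in> extreme_points (\<C> m n p q)"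
proof -
  obtain T where P: "P \<in> \<C> m n p q" and T: "\<not> has_circuit T" "T \<subseteq> box m n" "supp_mat m n P \<subseteq> T"
    using assms unfolding tree_polytope_pts_def is_tree_def by blast
  have "Q = R" if QR: "Q \<in> \<C> m n p q" "R \<in> \<C> m n p q" and t: "0 < t" "t < 1"
    and eq: "P = (\<lambda>x. t * Q x + (1 - t) * R x)" for Q R t
  proof (rule circuit_free_support_unique[OF QR T(1,2)])
    have nonneg: "0 \<le> Q x" "0 \<le> R x" for x using QR by (simp_all add: transport_polytope_nonneg)
    have "0 \<le> t * Q x" "0 \<le> (1 - t) * R x" "P x = t * Q x + (1 - t) * R x" for x
      using nonneg[of x] t eq by simp_all
    then have "Q x = 0" "R x = 0" if "P x = 0" for x
      using that t by (smt (verit) mult_eq_0_iff)+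
    then show "supp_mat m n Q \<subseteq> T" "supp_mat m n R \<subseteq> T"
      using T(3) by (auto simp: supp_mat_def)
  qed
  then show ?thesis using P unfolding extreme_points_def by blast
qed

text \<open>For small \<open>\<epsilon>\<close>, \<open>P\<close> is the midpoint of the two
  distinct members \<open>P + \<epsilon> * D\<close> and \<open>P - \<epsilon> * D\<close> of the
  polytope.\<close>

lemma perturbation_not_extreme:
  assumes P: "P \<in> \<C> m n p q" and D: "D \<noteq> (\<lambda>_. 0)" "\<forall>x. x \<notin> supp_mat m n P \<longrightarrow> D x = 0"
      "same_margins {1..m} {1..n} D (\<lambda>_. 0)"
  shows "P \<notin> extreme_points (\<C> m n p q)"
proof -
  let ?S = "supp_mat m n P"
  have fin: "finite ?S" by (simp add: supp_mat_def)
  have "?S \<noteq> {}" using D(1,2) by (auto simp: fun_eq_iff)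
  have nonneg: "0 \<le> P x" for x using P by (rule transport_polytope_nonneg)
  have "0 < P x" if "x \<in> ?S" for x using that nonneg[of x] by (simp add: supp_mat_def)
  \<comment> \<open>The summand 1 keeps the denominator positive where \<open>D\<close>
    vanishes.\<close>
  define \<epsilon> where "\<epsilon> = Min ((\<lambda>x. P x / (1 + \<bar>D x\<bar>)) ` ?S)"
  have "0 < \<epsilon>"
    unfolding \<epsilon>_def using fin \<open>?S \<noteq> {}\<close> \<open>\<And>x. x \<in> ?S \<Longrightarrow> 0 < P x\<close> by (subst Min_gr_iff) (auto intro!: divide_pos_pos)
  have bound: "\<epsilon> * \<bar>D x\<bar> \<le> P x" for x
  proof (cases "x \<in> ?S")
    case True
    then have "\<epsilon> \<le> P x / (1 + \<bar>D x\<bar>)" unfolding \<epsilon>_def using fin by (intro Min_le) auto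
    then have "\<epsilon> * (1 + \<bar>D x\<bar>) \<le> P x" by (simp add: pos_le_divide_eq)
    then show ?thesis using \<open>0 < \<epsilon>\<close> by (simp add: distrib_left)
  next
    case False
    then have "D x = 0" using D(2) by blast
    then show ?thesis using nonneg[of x] by simp
  qed
  have mem: "(\<lambda>x. P x + c * D x) \<in> \<C> m n p q" if c: "\<bar>c\<bar> = \<epsilon>" for c
  proof (rule transport_polytopeI[OF P])
    have "\<bar>c * D x\<bar> \<le> P x" for x using bound[of x] c by (simp add: abs_mult)
    then show "\<forall>x. 0 \<le> P x + c * D x" by (smt (verit))
    show "\<forall>x. x \<notin> box m n \<longrightarrow> P x + c * D x = 0"
      using transport_polytope_off_box[OF P] D(2) by (simp add: supp_mat_def)
    show "same_margins {1..m} {1..n} P (\<lambda>x. P x + c * D x)"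
      using D(3) by (simp add: same_margins_def sum.distrib flip: sum_distrib_left)
  qed
  obtain x where "D x \<noteq> 0" using D(1) by blast
  then have "P x + \<epsilon> * D x \<noteq> P x + - \<epsilon> * D x" using \<open>0 < \<epsilon>\<close> by simp
  then have "(\<lambda>x. P x + \<epsilon> * D x) \<noteq> (\<lambda>x. P x + - \<epsilon> * D x)" by metis
  moreover have "P = (\<lambda>x. 1/2 * (P x + \<epsilon> * D x) + (1 - 1/2) * (P x + - \<epsilon> * D x))"
    by (simp add: fun_eq_iff algebra_simps)
  moreover have "(0::real) < 1/2" "1/2 < (1::real)" by simp_all
  moreover have "\<bar>\<epsilon>\<bar> = \<epsilon>" "\<bar>- \<epsilon>\<bar> = \<epsilon>" using \<open>0 < \<epsilon>\<close> by simp_all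
  ultimately show ?thesis using mem unfolding extreme_points_def by blast
qed

text \<open>A cycle in the support would give a perturbation with zero margins; so the support is
  acyclic and extends to a spanning tree.\<close>

lemma extreme_tree_polytope_pts:
  assumes "P \<in> extreme_points (\<C> m n p q)" and mn: "1 \<le> m" "1 \<le> n"
  shows "P \<in> tree_polytope_pts m n p q"
proof -
  have P: "P \<in> \<C> m n p q" using assms(1) by (simp add: extreme_points_def)
  have sub: "supp_mat m n P \<subseteq> {1..m} \<times> {1..n}" by (auto simp: supp_mat_def box_def)
  have "\<nexists>s w. graph_cycle (supp_mat m n P) s w"
    using graph_cycle_kernel[OF _ sub] perturbation_not_extreme[OF P] assms(1) by blast
  then show ?thesis
    using extend_to_spanning_tree[OF _ _ _ _ sub] tree_polytope_ptsI[OF P] mn by fastforce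
qed

text \<open>The witness is the product coupling. Nonemptiness is what gives the infimum and the
  minimum their meaning.\<close>

lemma transport_polytope_nonempty:
  assumes p: "\<forall>i\<in>{1..m}. p i \<ge> 0" "(\<Sum>i=1..m. p i) = 1"
    and q: "\<forall>j\<in>{1..n}. q j \<ge> 0" "(\<Sum>j=1..n. q j) = 1"
  shows "\<C> m n p q \<noteq> {}"
proof -
  define P :: mat where "P x = (if x \<in> box m n then p (fst x) * q (snd x) else 0)" for x
  have "\<forall>x. 0 \<le> P x" using p(1) q(1) by (auto simp: P_def box_def)
  moreover have "\<forall>x. x \<notin> box m n \<longrightarrow> P x = 0" by (simp add: P_def)
  moreover have "\<forall>i\<in>{1..m}. (\<Sum>j=1..n. P (i, j)) = p i"
  proof
    fix i assume "i \<in> {1..m}"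
    then have "(\<Sum>j=1..n. P (i, j)) = (\<Sum>j=1..n. p i * q j)"
      by (intro sum.cong) (auto simp: P_def box_def)
    then show "(\<Sum>j=1..n. P (i, j)) = p i" by (simp only: sum_distrib_left[symmetric] q(2) mult_1_right)
  qed
  moreover have "\<forall>j\<in>{1..n}. (\<Sum>i=1..m. P (i, j)) = q j"
  proof
    fix j assume "j \<in> {1..n}"
    then have "(\<Sum>i=1..m. P (i, j)) = (\<Sum>i=1..m. p i * q j)"
      by (intro sum.cong) (auto simp: P_def box_def)
    then show "(\<Sum>i=1..m. P (i, j)) = q j" by (simp only: sum_distrib_right[symmetric] p(2) mult_1_left)
  qed
  ultimately have "P \<in> \<C> m n p q" unfolding transport_polytope_def by blast
  then show ?thesis by blast
qed

theorem theorem4p1: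
  fixes m n :: nat and p q :: "nat \<Rightarrow> real" and \<Psi> :: "mat \<Rightarrow> real"
  assumes "m \<ge> 2" and "n \<ge> 2"
    and "\<forall>i\<in>{1..m}. p i > 0" and "(\<Sum>i=1..m. p i) = 1"
    and "\<forall>j\<in>{1..n}. q j > 0" and "(\<Sum>j=1..n. q j) = 1"
    and "strict_schur_concave_on m n (\<C> m n p q) \<Psi>"
  shows "(\<forall>P\<in>\<C> m n p q. (\<forall>Q\<in>\<C> m n p q. \<Psi> P \<le> \<Psi> Q) \<longrightarrow> P \<in> tree_polytope_pts m n p q)
    \<and> finite (tree_polytope_pts m n p q)
    \<and> (\<exists>P0\<in>tree_polytope_pts m n p q. \<forall>P\<in>\<C> m n p q. \<Psi> P0 \<le> \<Psi> P)
    \<and> Inf (\<Psi> ` \<C> m n p q) = Min (\<Psi> ` tree_polytope_pts m n p q)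
    \<and> tree_polytope_pts m n p q = extreme_points (\<C> m n p q)"
proof -
  let ?C = "\<C> m n p q" and ?E = "tree_polytope_pts m n p q"
  have mn: "1 \<le> m" "1 \<le> n" using assms(1,2) by simp_all
  have sub: "?E \<subseteq> ?C" by (auto simp: tree_polytope_pts_def)
  have fin: "finite ?E" by (rule finite_tree_polytope_pts)
  \<comment> \<open>A point that is not its own spread is strictly majorized by a tree point, whose
    value is strictly smaller.\<close>
  have reduce: "\<exists>Q\<in>?E. P = Q \<or> \<Psi> Q < \<Psi> P" if P: "P \<in> ?C" for P
  proof -
    obtain Q where Q: "Q \<in> ?E" "spread (box m n) P Q" using spread_into_tree_polytope_pts[OF P mn] by blast
    then have "Q \<in> ?C" using sub by blast
    have "\<Psi> Q < \<Psi> P" if "P \<noteq> Q"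
      using spread_majorized(2)[OF P \<open>Q \<in> ?C\<close> Q(2) that] assms(7) P \<open>Q \<in> ?C\<close>
      by (simp add: strict_schur_concave_on_def)
    then show ?thesis using Q(1) by blast
  qed
  have "?C \<noteq> {}" by (rule transport_polytope_nonempty[OF _ assms(4) _ assms(6)]) (use assms(3,5) in force)+
  then have "?E \<noteq> {}" using reduce by blast
  then obtain P0 where P0: "P0 \<in> ?E" "\<And>P. P \<in> ?E \<Longrightarrow> \<Psi> P0 \<le> \<Psi> P"
    using fin by (metis arg_min_if_finite(1) arg_min_least)
  \<comment> \<open>Each value on the polytope is at least some value at a tree point, so the
    minimum over this finite set is global.\<close>
  have least: "\<Psi> P0 \<le> \<Psi> P" if "P \<in> ?C" for P using reduce[OF that] P0(2) by fastforce
  have "Inf (\<Psi> ` ?C) = \<Psi> P0" using P0(1) sub least by (intro cInf_eq_minimum) auto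
  moreover have "Min (\<Psi> ` ?E) = \<Psi> P0" using fin P0 by (intro Min_eqI) auto
  moreover have "?E = extreme_points ?C"
    using tree_polytope_pts_extreme extreme_tree_polytope_pts[OF _ mn] by blast
  \<comment> \<open>No value lies strictly below that of a minimizer, so \<open>reduce\<close>
    leaves only \<open>P = Q\<close>.\<close>
  moreover have "P \<in> ?E" if "P \<in> ?C" "\<forall>Q\<in>?C. \<Psi> P \<le> \<Psi> Q" for P
    using reduce[OF that(1)] that(2) sub by fastforce
  moreover have "Inf (\<Psi> ` ?C) = Min (\<Psi> ` ?E)" using calculation(1,2) by simp
  ultimately show ?thesis using fin P0(1) least by blast
qed

end
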